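(* Let $f\colon\mathbb{R}^d\to\mathbb{R}$ be a piecewise affine function such that $S(f)=\{x\in\mathbb{R}^d\mid f(x)\le 0\}$ is nonempty, and let $V\subseteq\mathbb{R}^d$ be a finite union of polyhedral sets. Then for $f$ to have an error bound on $V$ it is necessary and sufficient that $$S([f]_+^{\infty})\cap 0^+V\subseteq 0^+S(f).$$
   Context: $\mathbb{R}^d$ is equipped with an arbitrary norm $\|\cdot\|$; $\operatorname{dist}(x,Q)=\inf_{y\in Q}\|x-y\|$. A set is polyhedral if it is the intersection of finitely many closed half-spaces. A function $f\colon\mathbb{R}^d\to\mathbb{R}$ is piecewise affine if there are finitely many polyhedral sets $Q_1,\ldots,Q_s$ with nonempty, pairwise disjoint interiors covering $\mathbb{R}^d$ and affine functions $F_1,\ldots,F_s$ such that $f=F_k$ on $Q_k$ for each $k$. Equivalently (a known theorem of Gorokhovik and Zorko), $f(x)=\min_{i\in I}\max_{j\in J(i)}(a_{ij}+\langle v_{ij},x\rangle)$ for some finite index sets $I$, $J(i)$ and some $a_{ij}\in\mathbb{R}$, $v_{ij}\in\mathbb{R}^d$. For a function $g\colon\mathbb{R}^d\to\mathbb{R}$ put $S(g)=\{x\in\mathbb{R}^d\mid g(x)\le 0\}$ and $[g]_+(x)=\max\{g(x),0\}$. For a piecewise affine $g$, its recession function is $g^\infty(x)=\lim_{\lambda\to+\infty}g(\lambda x)/\lambda$; $[f]_+^\infty$ denotes the recession function of $[f]_+$. The function $f$ has an error bound on $V$ if there exists $\tau>0$ such that $\tau\operatorname{dist}(x,S(f))\le[f]_+(x)$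 for all $x\in V$. The recession cone $0^+Q$ of a nonempty set $Q\subseteq\mathbb{R}^d$ is the set of all $z\in\mathbb{R}^d$ for which there exists $x\in Q$ such that $x+\lambda z\in Q$ for all $\lambda\ge 0$. *)

theory Defs
  imports "HOL-Analysis.Analysis"
begin

text \<open>The norm on the space is arbitrary, so it is a parameter \<open>N\<close> and not the Euclidean norm of the
  type class. Topological notions such as \<^const>\<open>interior\<close> do not depend on it, as all norms on a
  finite-dimensional space are equivalent.\<close>

definition is_norm :: "(real ^ 'n \<Rightarrow> real) \<Rightarrow> bool" where
  "is_norm N \<longleftrightarrow>
     (\<forall>x. 0 \<le> N x) \<and>
     (\<forall>x. N x = 0 \<longleftrightarrow> x = 0) \<and>
     (\<forall>c x. N (c *\<^sub>R x) = \<bar>c\<bar> * N x) \<and>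
     (\<forall>x y. N (x + y) \<le> N x + N y)"

definition dist_to :: "(real ^ 'n \<Rightarrow> real) \<Rightarrow> real ^ 'n \<Rightarrow> (real ^ 'n) set \<Rightarrow> real" where
  "dist_to N x Q = (INF y\<in>Q. N (x - y))"

definition affine_fun :: "(real ^ 'n \<Rightarrow> real) \<Rightarrow> bool" where
  "affine_fun F \<longleftrightarrow> (\<exists>a v. \<forall>x. F x = a + v \<bullet> x)"

definition piecewise_affine :: "(real ^ 'n \<Rightarrow> real) \<Rightarrow> bool" where
  "piecewise_affine f \<longleftrightarrow>
     (\<exists>(s::nat) Q F.
        (\<forall>k\<in>{1..s}. polyhedron (Q k) \<and> interior (Q k) \<noteq> {}) \<and>
        (\<forall>k\<in>{1..s}. \<forall>l\<in>{1..s}. k \<noteq> l \<longrightarrow> interior (Q k) \<inter> interior (Q l) = {}) \<and>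
        (\<Union>k\<in>{1..s}. Q k) = UNIV \<and>
        (\<forall>k\<in>{1..s}. affine_fun (F k) \<and> (\<forall>x\<in>Q k. f x = F k x)))"

definition sublevel :: "(real ^ 'n \<Rightarrow> real) \<Rightarrow> (real ^ 'n) set" where
  "sublevel g = {x. g x \<le> 0}"

definition pos_part :: "(real ^ 'n \<Rightarrow> real) \<Rightarrow> real ^ 'n \<Rightarrow> real" where
  "pos_part g x = max (g x) 0"

text \<open>\<^const>\<open>Lim\<close> is unspecified where the limit does not exist; for piecewise affine \<open>g\<close> it
  always exists.\<close>

definition recession_fun :: "(real ^ 'n \<Rightarrow> real) \<Rightarrow> real ^ 'n \<Rightarrow> real" where
  "recession_fun g x = Lim at_top (\<lambda>t::real. g (t *\<^sub>R x) / t)"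

definition recession_cone :: "(real ^ 'n) set \<Rightarrow> (real ^ 'n) set" where
  "recession_cone Q = {z. \<exists>x\<in>Q. \<forall>t\<ge>0. x + t *\<^sub>R z \<in> Q}"

definition has_error_bound ::
  "(real ^ 'n \<Rightarrow> real) \<Rightarrow> (real ^ 'n \<Rightarrow> real) \<Rightarrow> (real ^ 'n) set \<Rightarrow> bool" where
  "has_error_bound N f V \<longleftrightarrow>
     (\<exists>\<tau>>0. \<forall>x\<in>V. \<tau> * dist_to N x (sublevel f) \<le> pos_part f x)"

definition polyhedral_union :: "(real ^ 'n) set \<Rightarrow> bool" where
  "polyhedral_union V \<longleftrightarrow> (\<exists>\<P>. finite \<P> \<and> (\<forall>P\<in>\<P>. polyhedron P) \<and> V = \<Union>\<P>)"

end

theory Submission imports Defs begin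

text \<open>Necessity: along a ray \<open>x + t z\<close> in \<open>V\<close> on which the positive part of \<open>f\<close> grows sublinearly, the
  error bound yields points \<open>y\<^sub>n\<close> of the sublevel set with \<open>y\<^sub>n / n\<close> tending to \<open>z\<close>. Infinitely many of them lie
  in one of the finitely many polyhedra making up the sublevel set, so \<open>z\<close> is a recession direction of it.

  Sufficiency: it is enough to treat a polyhedron \<open>W \<subseteq> V\<close> on which \<open>f\<close> is affine. If \<open>f\<close> is
  nonpositive somewhere on \<open>W\<close>, Hoffman's bound applies. Otherwise \<open>f\<close> is bounded away from zero on \<open>W\<close>,
  and every \<open>x \<in> W\<close> lies within \<open>C f(x)\<close> of a recession direction \<open>z\<close> of \<open>W\<close> along which \<open>f\<close> is constant. The
  hypothesis puts \<open>z\<close> into the recession cone of the sublevel set, and such \<open>z\<close> have bounded distance from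
  the sublevel set, because \<open>p + z\<close> belongs to it for one of finitely many fixed points \<open>p\<close>.\<close>

section \<open>Finitely generated cones and polyhedra\<close>

lemma convex_cone_hull_sum:
  assumes "\<And>i. i \<in> I \<Longrightarrow> g i \<in> convex_cone hull G"
  shows "(\<Sum>i\<in>I. g i) \<in> convex_cone hull G"
  using assms
  by (induction I rule: infinite_finite_induct)
    (auto simp: convex_cone_hull_contains_0 convex_cone_hull_add)

text \<open>The nonnegative combinations of \<open>G\<close> form a convex cone containing
  \<open>G\<close>; the hull is the smallest such cone, so all its elements are of this
  form.\<close>

lemma convex_cone_hull_finite_obtain:
  assumes "finite G" "x \<in> convex_cone hull G"
  obtains c where "\<And>g. g \<in> G \<Longrightarrow> 0 \<le> c g" "x = (\<Sum>g\<in>G. c g *\<^sub>R g)"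
proof -
  let ?S = "{x. \<exists>c. (\<forall>g\<in>G. 0 \<le> c g) \<and> x = (\<Sum>g\<in>G. c g *\<^sub>R g)}"
  have "convex_cone ?S"
    unfolding convex_cone_iff
  proof (safe, goal_cases)
    case 1
    show ?case by (rule exI[of _ "\<lambda>_. 0"]) auto
  next
    case (2 x y c d)
    then show ?case
      by (intro exI[of _ "\<lambda>g. c g + d g"]) (auto simp: scaleR_add_left sum.distrib)
  next
    case (3 x c k)
    then show ?case
      by (intro exI[of _ "\<lambda>g. k * c g"]) (auto simp: scaleR_sum_right)
  qed
  moreover have "G \<subseteq> ?S"
  proof
    fix x assume "x \<in> G"
    then show "x \<in> ?S"
      using assms(1)
      by (auto intro!: exI[of _ "\<lambda>g. if g = x then 1 else 0"] simp: if_distrib[of "\<lambda>c. c *\<^sub>R _"] cong: if_cong)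
  qed
  ultimately have "convex_cone hull G \<subseteq> ?S"
    by (rule hull_minimal[rotated])
  then show ?thesis using assms(2) that by blast
qed

text \<open>One step of the double description method: cut away the rays on the wrong side of the
  half-space and add, for each pair of rays on opposite sides, their combination on the boundary.\<close>

lemma finitely_generated_cone_Int_halfspace:
  fixes G :: "'a::real_inner set"
  assumes "finite G"
  obtains G' where "finite G'" "convex_cone hull G' = convex_cone hull G \<inter> {x. a \<bullet> x \<le> 0}"
proof -
  define P where "P = {g\<in>G. a \<bullet> g > 0}"
  define M where "M = {g\<in>G. a \<bullet> g \<le> 0}"
  define comb where "comb = (\<lambda>(p, m). (- (a \<bullet> m)) *\<^sub>R p + (a \<bullet> p) *\<^sub>R m)"
  define G' where "G' = M \<union> comb ` (P \<times> M)"
  have fin: "finite P" "finite M" "finite G'" using assms by (auto simp: P_def M_def G'_def)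
  have G: "G = P \<union> M" "P \<inter> M = {}" by (auto simp: P_def M_def)
  have "G' \<subseteq> convex_cone hull G \<inter> {x. a \<bullet> x \<le> 0}"
  proof -
    have "comb (p, m) \<in> convex_cone hull G \<inter> {x. a \<bullet> x \<le> 0}" if "p \<in> P" "m \<in> M" for p m
    proof
      show "comb (p, m) \<in> convex_cone hull G"
        unfolding comb_def prod.case
        by (intro convex_cone_hull_add convex_cone_hull_mul hull_inc)
          (use that in \<open>auto simp: P_def M_def\<close>)
      show "comb (p, m) \<in> {x. a \<bullet> x \<le> 0}" by (simp add: comb_def inner_diff_right)
    qed
    moreover have "M \<subseteq> convex_cone hull G \<inter> {x. a \<bullet> x \<le> 0}" by (auto simp: M_def hull_inc)
    ultimately show ?thesis unfolding G'_def by blast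
  qed
  moreover have "convex_cone (convex_cone hull G \<inter> {x. a \<bullet> x \<le> 0})"
    using convex_cone_convex_cone_hull[of G] convex_cone_halfspace_le[of a]
    unfolding convex_cone_iff by blast
  ultimately have sub: "convex_cone hull G' \<subseteq> convex_cone hull G \<inter> {x. a \<bullet> x \<le> 0}"
    by (rule hull_minimal)
  have "x \<in> convex_cone hull G'" if x: "x \<in> convex_cone hull G" "a \<bullet> x \<le> 0" for x
  proof -
    obtain c where c: "\<And>g. g \<in> G \<Longrightarrow> 0 \<le> c g" "x = (\<Sum>g\<in>G. c g *\<^sub>R g)"
      using convex_cone_hull_finite_obtain[OF assms x(1)] by blast
    define p where "p = (\<Sum>g\<in>P. c g *\<^sub>R g)"
    define m where "m = (\<Sum>g\<in>M. c g *\<^sub>R g)"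
    define A where "A = a \<bullet> p"
    define B where "B = - (a \<bullet> m)"
    have xpm: "x = p + m"
      using fin G by (simp add: c(2) p_def m_def sum.union_disjoint)
    then have AB: "A \<le> B" using x(2) by (simp add: A_def B_def inner_right_distrib)
    have A: "A = (\<Sum>g\<in>P. c g * (a \<bullet> g))" by (simp add: A_def p_def inner_sum_right)
    have B: "B = (\<Sum>g\<in>M. c g * (- (a \<bullet> g)))" by (simp add: B_def m_def inner_sum_right sum_negf)
    have m_in: "m \<in> convex_cone hull G'"
      unfolding m_def by (intro convex_cone_hull_sum convex_cone_hull_mul hull_inc)
        (use c(1) G in \<open>auto simp: G'_def\<close>)
    have A0: "A \<ge> 0" unfolding A using c(1) by (intro sum_nonneg) (auto simp: P_def)
    \<comment> \<open>If \<open>A = 0\<close>, all weights on \<open>P\<close> vanish and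
      \<open>x = m\<close>; otherwise \<open>B \<ge> A > 0\<close> permits division by
      \<open>B\<close>.\<close>
    show ?thesis
    proof (cases "A = 0")
      case True
      then have "\<forall>g\<in>P. c g * (a \<bullet> g) = 0"
        unfolding A using fin c(1) by (subst (asm) sum_nonneg_eq_0_iff) (auto simp: P_def)
      then have "p = 0" unfolding p_def by (intro sum.neutral) (auto simp: P_def)
      then show ?thesis using xpm m_in by simp
    next
      case False
      then have B0: "B > 0" using A0 AB by simp
      \<comment> \<open>Weighting the pair \<open>(g, h)\<close> by \<open>c g * c h\<close> makes
        the double sum factor into \<open>B p + A m\<close>. Divided by \<open>B\<close> it supplies
        \<open>p\<close> and the share \<open>A / B\<close> of \<open>m\<close>; the remaining share
        \<open>1 - A / B\<close> is nonnegative because \<open>A \<le> B\<close>.\<close>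
      have "(\<Sum>(g,h)\<in>P\<times>M. (c g * c h) *\<^sub>R comb (g,h))
          = (\<Sum>g\<in>P. \<Sum>h\<in>M. (c h * (- (a \<bullet> h))) *\<^sub>R c g *\<^sub>R g + (c g * (a \<bullet> g)) *\<^sub>R c h *\<^sub>R h)"
        unfolding sum.cartesian_product comb_def
        by (intro sum.cong) (auto simp: scaleR_diff_right mult_ac)
      also have "\<dots> = B *\<^sub>R p + A *\<^sub>R m"
        by (simp only: sum.distrib scaleR_sum_left[symmetric] scaleR_sum_right[symmetric]
            A[symmetric] B[symmetric] p_def[symmetric] m_def[symmetric])
      finally have "x = (1 / B) *\<^sub>R (\<Sum>(g,h)\<in>P\<times>M. (c g * c h) *\<^sub>R comb (g,h)) + (1 - A / B) *\<^sub>R m"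
        using B0 xpm by (simp add: scaleR_add_right algebra_simps)
      moreover have "(\<Sum>(g,h)\<in>P\<times>M. (c g * c h) *\<^sub>R comb (g,h)) \<in> convex_cone hull G'"
        unfolding case_prod_unfold
        by (intro convex_cone_hull_sum convex_cone_hull_mul hull_inc mult_nonneg_nonneg)
          (use c(1) G in \<open>auto simp: G'_def\<close>)
      ultimately show ?thesis
        using m_in B0 AB by (auto intro!: convex_cone_hull_add convex_cone_hull_mul)
    qed
  qed
  with sub have "convex_cone hull G' = convex_cone hull G \<inter> {x. a \<bullet> x \<le> 0}" by blast
  with fin(3) show ?thesis by (rule that)
qed

lemma finitely_generated_UNIV:
  obtains G :: "'a::euclidean_space set" where "finite G" "convex_cone hull G = UNIV"
proof -
  define G :: "'a set" where "G = Basis \<union> uminus ` Basis"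
  have "c *\<^sub>R b \<in> convex_cone hull G" if "b \<in> Basis" for c :: real and b :: 'a
  proof (cases "c \<ge> 0")
    case True
    then show ?thesis using that by (intro convex_cone_hull_mul hull_inc) (auto simp: G_def)
  next
    case False
    then have "(- c) *\<^sub>R (- b) \<in> convex_cone hull G"
      using that by (intro convex_cone_hull_mul hull_inc) (auto simp: G_def)
    then show ?thesis by simp
  qed
  then have "(\<Sum>b\<in>Basis. (x \<bullet> b) *\<^sub>R b) \<in> convex_cone hull G" for x :: 'a
    by (intro convex_cone_hull_sum) auto
  then have "convex_cone hull G = UNIV" by (auto simp: euclidean_representation)
  moreover have "finite G" by (simp add: G_def)
  ultimately show ?thesis using that by blast
qed

text \<open>Induction on the half-spaces, starting from the whole space, which is generated by the
  basis vectors and their negatives.\<close>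

lemma polyhedral_cone_finitely_generated:
  fixes A :: "'a::euclidean_space set"
  assumes "finite A"
  obtains G where "finite G" "convex_cone hull G = {x. \<forall>a\<in>A. a \<bullet> x \<le> 0}"
proof -
  have "\<exists>G. finite G \<and> convex_cone hull G = {x. \<forall>a\<in>A. a \<bullet> x \<le> 0}"
    using assms
  proof induction
    case empty
    obtain G :: "'a set" where "finite G" "convex_cone hull G = UNIV"
      using finitely_generated_UNIV by blast
    then show ?case by auto
  next
    case (insert a A)
    then obtain G where G: "finite G" "convex_cone hull G = {x. \<forall>a\<in>A. a \<bullet> x \<le> 0}" by blast
    obtain G' where "finite G'" "convex_cone hull G' = convex_cone hull G \<inter> {x. a \<bullet> x \<le> 0}"
      using finitely_generated_cone_Int_halfspace[OF G(1)] .
    then show ?case using G(2) by (intro exI[of _ G']) auto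
  qed
  then show ?thesis using that by blast
qed

text \<open>The Minkowski--Weyl theorem in homogeneous form: the points of the polyhedron sit at height
  1 in the cone, its recession directions at height 0.\<close>

lemma polyhedron_homogenization:
  fixes W :: "'a::euclidean_space set"
  assumes "polyhedron W"
  obtains G :: "('a \<times> real) set" where "finite G" "\<And>g. g \<in> G \<Longrightarrow> 0 \<le> snd g"
    "\<And>x. x \<in> W \<longleftrightarrow> (x, 1) \<in> convex_cone hull G"
proof -
  obtain H where H: "finite H" "W = \<Inter>H" "\<forall>h\<in>H. \<exists>a b. a \<noteq> 0 \<and> h = {x. a \<bullet> x \<le> b}"
    using assms unfolding polyhedron_def by blast
  then obtain a b where ab: "\<And>h. h \<in> H \<Longrightarrow> h = {x. a h \<bullet> x \<le> b h}" by metis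
  \<comment> \<open>\<open>(a h, - b h)\<close> homogenizes \<open>a h \<bullet> x \<le> b h\<close>
    by letting the height multiply \<open>b h\<close>; \<open>(0, -1)\<close> keeps the height
    nonnegative.\<close>
  define A where "A = insert (0, -1) ((\<lambda>h. (a h, - b h)) ` H)"
  obtain G where G: "finite G" "convex_cone hull G = {x. \<forall>a\<in>A. a \<bullet> x \<le> 0}"
    using polyhedral_cone_finitely_generated[of A] H(1) by (auto simp: A_def)
  have "x \<in> W \<longleftrightarrow> (x, 1) \<in> convex_cone hull G" for x
  proof -
    have "x \<in> W \<longleftrightarrow> (\<forall>h\<in>H. a h \<bullet> x \<le> b h)" unfolding H(2) using ab by blast
    then show ?thesis unfolding G(2) A_def by simp
  qed
  moreover have "0 \<le> snd g" if "g \<in> G" for g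
    using hull_inc[OF that, of convex_cone] unfolding G(2) A_def by (cases g) auto
  ultimately show ?thesis using that G(1) by blast
qed

section \<open>Recession directions of unions of convex sets\<close>

text \<open>The point \<open>p + t z\<close> is the limit of the points that divide the segments
  from \<open>p\<close> to \<open>y n\<close> in the ratio given by the weight \<open>t / n\<close>.
  Convexity puts these into \<open>C\<close> for large \<open>n\<close>, and closedness keeps the
  limit there; a subsequence of \<open>y\<close> in \<open>C\<close> is enough.\<close>

lemma closed_convex_recession_limit:
  fixes C :: "'a::real_normed_vector set"
  assumes C: "closed C" "convex C" "p \<in> C" and y: "infinite {n. y n \<in> C}"
    and lim: "(\<lambda>n::nat. y n /\<^sub>R real n) \<longlonglongrightarrow> z" and t: "0 \<le> t"
  shows "p + t *\<^sub>R z \<in> C"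
proof -
  obtain r :: "nat \<Rightarrow> nat" where r: "strict_mono r" "\<forall>n. r n \<in> {n. y n \<in> C}"
    using infinite_enumerate[OF y] by blast
  then have yC: "\<And>n. y (r n) \<in> C" by simp
  let ?u = "\<lambda>n. (1 - t / real (r n)) *\<^sub>R p + (t / real (r n)) *\<^sub>R y (r n)"
  have top: "filterlim (\<lambda>n. real (r n)) at_top sequentially"
    by (rule filterlim_compose[OF filterlim_real_sequentially filterlim_subseq[OF r(1)]])
  have t0: "(\<lambda>n. t / real (r n)) \<longlonglongrightarrow> 0"
    by (rule real_tendsto_divide_at_top[OF tendsto_const top])
  have "(\<lambda>n. (1 - t / real (r n)) *\<^sub>R p + t *\<^sub>R (y (r n) /\<^sub>R real (r n))) \<longlonglongrightarrow> (1 - 0) *\<^sub>R p + t *\<^sub>R z"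
    using LIMSEQ_subseq_LIMSEQ[OF lim r(1)] by (intro tendsto_intros t0) (simp add: o_def)
  then have "?u \<longlonglongrightarrow> p + t *\<^sub>R z" by (simp add: divide_inverse)
  \<comment> \<open>\<open>t\<close> makes the weight at most 1, and 1 keeps the divisor
    positive.\<close>
  moreover have "\<forall>\<^sub>F n in sequentially. real (r n) \<ge> max t 1"
    using top unfolding filterlim_at_top by blast
  then have "\<forall>\<^sub>F n in sequentially. ?u n \<in> C"
  proof eventually_elim
    case (elim n)
    then show ?case using t by (intro convexD[OF C(2,3) yC]) (auto simp: divide_le_eq)
  qed
  ultimately show ?thesis by (intro Lim_in_closed_set[OF C(1) _ trivial_limit_sequentially])
qed

text \<open>By the pigeonhole principle one member contains \<open>y n\<close> for infinitely many
  \<open>n\<close>. The conclusion covers every base point of \<open>C\<close>, so a point fixed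
  independently of \<open>z\<close> can be used later.\<close>

lemma recession_limit_Union:
  fixes \<C> :: "'a::real_normed_vector set set"
  assumes "finite \<C>" "\<And>C. C \<in> \<C> \<Longrightarrow> closed C \<and> convex C"
    and "\<And>n. y n \<in> \<Union>\<C>" and "(\<lambda>n::nat. y n /\<^sub>R real n) \<longlonglongrightarrow> z"
  obtains C where "C \<in> \<C>" "C \<noteq> {}" "\<And>p t. p \<in> C \<Longrightarrow> 0 \<le> t \<Longrightarrow> p + t *\<^sub>R z \<in> C"
proof -
  have "\<exists>C\<in>\<C>. infinite {n\<in>UNIV. y n \<in> C}"
    using assms(1,3) by (intro pigeonhole_infinite_rel) auto
  then obtain C where C: "C \<in> \<C>" "infinite {n. y n \<in> C}" by auto
  then have "C \<noteq> {}" by auto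
  then show ?thesis
    using that[OF C(1)] closed_convex_recession_limit[OF _ _ _ C(2) assms(4)] assms(2)[OF C(1)] by blast
qed

lemma ray_recession_limit:
  fixes x z :: "'a::real_normed_vector"
  shows "(\<lambda>n::nat. (x + real n *\<^sub>R z) /\<^sub>R real n) \<longlonglongrightarrow> z"
proof -
  have "(\<lambda>n::nat. inverse (real n) *\<^sub>R x + z) \<longlonglongrightarrow> 0 *\<^sub>R x + z"
    by (intro tendsto_intros lim_inverse_n)
  moreover have "\<forall>\<^sub>F n::nat in sequentially. inverse (real n) *\<^sub>R x + z = (x + real n *\<^sub>R z) /\<^sub>R real n"
    using eventually_gt_at_top[of 0] by eventually_elim (simp add: scaleR_add_right)
  ultimately show ?thesis by (simp add: filterlim_cong)
qed

text \<open>One member contains the ray at infinitely many integer parameters; convexity fills the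
  gaps, so the ray stays in it from the parameter \<open>m\<close> on.\<close>

lemma ray_eventually_in_convex:
  fixes x z :: "'a::real_normed_vector"
  assumes "finite \<C>" "\<And>C. C \<in> \<C> \<Longrightarrow> convex C" "\<Union>\<C> = UNIV"
  obtains C T where "C \<in> \<C>" "\<And>t. T \<le> t \<Longrightarrow> x + t *\<^sub>R z \<in> C"
proof -
  have "\<exists>C\<in>\<C>. infinite {n\<in>UNIV. x + real n *\<^sub>R z \<in> C}"
    using assms(1,3) by (intro pigeonhole_infinite_rel) auto
  then obtain C where C: "C \<in> \<C>" "infinite {n. x + real n *\<^sub>R z \<in> C}" by auto
  have "convex C" using assms(2) C(1) .
  have conv: "convex ((\<lambda>t. x + t *\<^sub>R z) -` C)"
  proof (intro convexI)
    fix s t u v :: real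
    assume st: "s \<in> (\<lambda>t. x + t *\<^sub>R z) -` C" "t \<in> (\<lambda>t. x + t *\<^sub>R z) -` C"
      and uv: "0 \<le> u" "0 \<le> v" "u + v = 1"
    have "u *\<^sub>R (x + s *\<^sub>R z) + v *\<^sub>R (x + t *\<^sub>R z) \<in> C"
      using convexD[OF \<open>convex C\<close>] st uv by auto
    also have "u *\<^sub>R (x + s *\<^sub>R z) + v *\<^sub>R (x + t *\<^sub>R z) = (u + v) *\<^sub>R x + (u * s + v * t) *\<^sub>R z"
      by (simp add: algebra_simps)
    finally show "u *\<^sub>R s + v *\<^sub>R t \<in> (\<lambda>t. x + t *\<^sub>R z) -` C" using uv by simp
  qed
  obtain m where m: "x + real m *\<^sub>R z \<in> C"
    using C(2) not_finite_existsD by force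
  have "x + t *\<^sub>R z \<in> C" if t: "real m \<le> t" for t
  proof -
    obtain n where n: "nat \<lceil>t\<rceil> \<le> n" "x + real n *\<^sub>R z \<in> C"
      using C(2) unfolding infinite_nat_iff_unbounded_le by blast
    then have t': "t \<in> {real m..real n}" using t by (auto simp: nat_le_iff ceiling_le_iff)
    also have "{real m..real n} = closed_segment (real m) (real n)"
      using t' by (simp add: closed_segment_eq_real_ivl)
    also have "\<dots> \<subseteq> (\<lambda>t. x + t *\<^sub>R z) -` C"
      using conv m n(2) by (intro closed_segment_subset) auto
    finally show ?thesis by simp
  qed
  then show ?thesis using that C(1) by blast
qed

section \<open>Piecewise affine functions\<close>

lemma piecewise_affine_obtain:
  assumes "piecewise_affine f"
  obtains K :: "nat set" and Q a v where "finite K" "\<forall>k\<in>K. polyhedron (Q k)"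
    "(\<Union>k\<in>K. Q k) = UNIV" "\<forall>k\<in>K. \<forall>x\<in>Q k. f x = a k + v k \<bullet> x"
proof -
  obtain s :: nat and Q F where Q: "\<forall>k\<in>{1..s}. polyhedron (Q k) \<and> interior (Q k) \<noteq> {}"
      "(\<Union>k\<in>{1..s}. Q k) = UNIV"
    and F: "\<forall>k\<in>{1..s}. affine_fun (F k) \<and> (\<forall>x\<in>Q k. f x = F k x)"
    using assms unfolding piecewise_affine_def by (elim exE conjE) (rule that)
  have "\<exists>a v. \<forall>x\<in>Q k. f x = a + v \<bullet> x" if k: "k \<in> {1..s}" for k
  proof -
    obtain a v where "\<forall>x. F k x = a + v \<bullet> x"
      using F k unfolding affine_fun_def by blast
    then show ?thesis using F k by (intro exI[of _ a] exI[of _ v]) simp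
  qed
  then have "\<forall>k\<in>{1..s}. \<exists>a v. \<forall>x\<in>Q k. f x = a + v \<bullet> x" ..
  then obtain a where "\<forall>k\<in>{1..s}. \<exists>v. \<forall>x\<in>Q k. f x = a k + v \<bullet> x"
    unfolding bchoice_iff by blast
  then obtain v where av: "\<forall>k\<in>{1..s}. \<forall>x\<in>Q k. f x = a k + v k \<bullet> x"
    unfolding bchoice_iff by blast
  have "\<forall>k\<in>{1..s}. polyhedron (Q k)" using Q(1) by blast
  from that[OF finite_atLeastAtMost this Q(2) av] show ?thesis .
qed

text \<open>Along a segment the pieces pull back to finitely many closed sets covering the unit
  interval. On each of them the restriction of \<open>f\<close> has the same Lipschitz constant, and
  such estimates glue on an interval.\<close>

lemma piecewise_affine_lipschitz:
  assumes "piecewise_affine f"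
  obtains L where "\<And>x y. \<bar>f x - f y\<bar> \<le> L * norm (x - y)"
proof -
  obtain K :: "nat set" and Q a v where K [rule_format]: "finite K" "\<forall>k\<in>K. polyhedron (Q k)"
    "(\<Union>k\<in>K. Q k) = UNIV" "\<forall>k\<in>K. \<forall>x\<in>Q k. f x = a k + v k \<bullet> x"
    by (rule piecewise_affine_obtain[OF assms]) (rule that)
  define L where "L = (\<Sum>k\<in>K. norm (v k))"
  have L: "norm (v k) \<le> L" if "k \<in> K" for k
    unfolding L_def using K(1) that by (intro member_le_sum) auto
  have "\<bar>f x - f y\<bar> \<le> L * norm (x - y)" for x y
  proof -
    define h where "h = (\<lambda>t::real. y + t *\<^sub>R (x - y))"
    have "lipschitz_on (L * norm (x - y)) {0..1} (f \<circ> h)"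
    proof (rule lipschitz_on_closed_Union)
      fix k assume k: "k \<in> K"
      show "closed (h -` Q k)"
        unfolding h_def using polyhedron_imp_closed[OF K(2)[OF k]]
        by (intro closed_vimage continuous_intros)
      show "lipschitz_on (L * norm (x - y)) (h -` Q k) (f \<circ> h)"
      proof (rule lipschitz_onI)
        fix s t assume "s \<in> h -` Q k" "t \<in> h -` Q k"
        then have "(f \<circ> h) s - (f \<circ> h) t = v k \<bullet> ((s - t) *\<^sub>R (x - y))"
          using K(4)[OF k] by (simp add: h_def algebra_simps)
        also have "\<bar>\<dots>\<bar> \<le> norm (v k) * norm ((s - t) *\<^sub>R (x - y))"
          by (rule Cauchy_Schwarz_ineq2)
        also have "\<dots> \<le> L * norm ((s - t) *\<^sub>R (x - y))"
          by (intro mult_right_mono L k) auto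
        finally show "dist ((f \<circ> h) s) ((f \<circ> h) t) \<le> L * norm (x - y) * dist s t"
          by (simp add: dist_real_def mult_ac)
      qed (auto simp: L_def intro!: mult_nonneg_nonneg sum_nonneg)
    next
      show "{0..1} \<subseteq> (\<Union>k\<in>K. h -` Q k)" using K(3) by (auto simp: set_eq_iff)
    qed (use K(1) in \<open>auto simp: L_def intro!: mult_nonneg_nonneg sum_nonneg\<close>)
    from lipschitz_onD[OF this, of 1 0] show ?thesis
      by (simp add: h_def dist_real_def)
  qed
  then show ?thesis by (rule that)
qed

text \<open>On each piece the condition \<open>f x \<le> 0\<close> cuts out a half-space. This
  brings the sublevel set into the form required by \<open>recession_limit_Union\<close>.\<close>

lemma sublevel_piecewise_affine:
  assumes "piecewise_affine f"
  obtains \<C> where "finite \<C>" "\<And>C. C \<in> \<C> \<Longrightarrow> closed C \<and> convex C" "sublevel f = \<Union>\<C>"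
proof -
  obtain K :: "nat set" and Q a v where K [rule_format]: "finite K" "\<forall>k\<in>K. polyhedron (Q k)"
    "(\<Union>k\<in>K. Q k) = UNIV" "\<forall>k\<in>K. \<forall>x\<in>Q k. f x = a k + v k \<bullet> x"
    by (rule piecewise_affine_obtain[OF assms]) (rule that)
  let ?C = "\<lambda>k. Q k \<inter> {x. v k \<bullet> x \<le> - a k}"
  have eq: "f x \<le> 0 \<longleftrightarrow> v k \<bullet> x \<le> - a k" if "k \<in> K" "x \<in> Q k" for k x
    using K(4)[OF that] by linarith
  have un: "sublevel f = (\<Union>k\<in>K. ?C k)"
  proof (intro set_eqI iffI)
    fix x assume "x \<in> sublevel f"
    moreover obtain k where k: "k \<in> K" "x \<in> Q k" using K(3) by blast
    ultimately have "x \<in> ?C k" using eq[OF k] by (simp add: sublevel_def)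
    then show "x \<in> (\<Union>k\<in>K. ?C k)" by (rule UN_I[OF k(1)])
  next
    fix x assume "x \<in> (\<Union>k\<in>K. ?C k)"
    then show "x \<in> sublevel f" using eq by (auto simp: sublevel_def)
  qed
  have "closed (?C k) \<and> convex (?C k)" if "k \<in> K" for k
    using K(2)[OF that]
    by (intro conjI closed_Int convex_Int polyhedron_imp_closed polyhedron_imp_convex
        closed_halfspace_le convex_halfspace_le)
  then have "closed C \<and> convex C" if "C \<in> ?C ` K" for C using that by blast
  with finite_imageI[OF K(1)] show ?thesis using un by (rule that)
qed

text \<open>The ray from the origin finally stays in one piece, where the quotient is explicit; so
  the limit exists and \<open>Lim\<close> in the definition denotes it. Starting at \<open>w\<close>
  instead changes the numerator by at most \<open>L * norm w\<close>, which division by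
  \<open>t\<close> makes negligible.\<close>

lemma recession_fun_tendsto:
  assumes "piecewise_affine f"
  shows "((\<lambda>t. pos_part f (w + t *\<^sub>R z) / t) \<longlongrightarrow> recession_fun (pos_part f) z) at_top"
proof -
  obtain K :: "nat set" and Q a v where K [rule_format]: "finite K" "\<forall>k\<in>K. polyhedron (Q k)"
    "(\<Union>k\<in>K. Q k) = UNIV" "\<forall>k\<in>K. \<forall>x\<in>Q k. f x = a k + v k \<bullet> x"
    by (rule piecewise_affine_obtain[OF assms]) (rule that)
  have "convex C" if "C \<in> Q ` K" for C using that K(2) polyhedron_imp_convex by blast
  then obtain C T where C: "C \<in> Q ` K" "\<And>t. T \<le> t \<Longrightarrow> 0 + t *\<^sub>R z \<in> C"
    using ray_eventually_in_convex[OF finite_imageI[OF K(1)] _ K(3)] by blast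
  then obtain k where k: "k \<in> K" "C = Q k" by blast
  then have kT: "t *\<^sub>R z \<in> Q k" if "T \<le> t" for t using C(2)[OF that] by simp
  have "((\<lambda>t. max (a k / t + v k \<bullet> z) 0) \<longlongrightarrow> max (0 + v k \<bullet> z) 0) at_top"
    by (intro tendsto_max tendsto_add tendsto_const real_tendsto_divide_at_top[OF tendsto_const filterlim_ident])
  moreover have "\<forall>\<^sub>F t in at_top. max (a k / t + v k \<bullet> z) 0 = pos_part f (t *\<^sub>R z) / t"
    using eventually_ge_at_top[of T] eventually_gt_at_top[of 0]
  proof eventually_elim
    case (elim t)
    then have "f (t *\<^sub>R z) = t * (a k / t + v k \<bullet> z)"
      using K(4)[OF k(1) kT] by (simp add: field_simps)
    then show ?case using elim by (simp add: pos_part_def max_def zero_le_mult_iff mult_le_0_iff)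
  qed
  ultimately have "((\<lambda>t. pos_part f (t *\<^sub>R z) / t) \<longlongrightarrow> max (0 + v k \<bullet> z) 0) at_top"
    by (rule Lim_transform_eventually)
  then have lim0: "((\<lambda>t. pos_part f (t *\<^sub>R z) / t) \<longlongrightarrow> recession_fun (pos_part f) z) at_top"
    unfolding recession_fun_def by (simp add: tendsto_Lim[OF trivial_limit_at_top_linorder])
  obtain L where L: "\<And>x y. \<bar>f x - f y\<bar> \<le> L * norm (x - y)"
    using piecewise_affine_lipschitz[OF assms] by blast
  have "((\<lambda>t. pos_part f (w + t *\<^sub>R z) / t - pos_part f (t *\<^sub>R z) / t) \<longlongrightarrow> 0) at_top"
  proof (rule Lim_null_comparison)
    show "((\<lambda>t::real. L * norm w / t) \<longlongrightarrow> 0) at_top"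
      by (rule real_tendsto_divide_at_top[OF tendsto_const filterlim_ident])
    show "\<forall>\<^sub>F t in at_top. norm (pos_part f (w + t *\<^sub>R z) / t - pos_part f (t *\<^sub>R z) / t) \<le> L * norm w / t"
      using eventually_gt_at_top[of 0]
    proof eventually_elim
      case (elim t)
      have "\<bar>pos_part f (w + t *\<^sub>R z) - pos_part f (t *\<^sub>R z)\<bar> \<le> L * norm w"
        using L[of "w + t *\<^sub>R z" "t *\<^sub>R z"] unfolding pos_part_def add_diff_cancel_right' by linarith
      then show ?case using elim
        by (simp add: diff_divide_distrib[symmetric] divide_right_mono)
    qed
  qed
  from tendsto_add[OF this lim0] show ?thesis by (simp only: diff_add_cancel add_0)
qed

section \<open>Distances in an arbitrary norm\<close>

lemma is_norm_sum:
  assumes "is_norm N" "\<And>i. i \<in> I \<Longrightarrow> 0 \<le> c i"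
  shows "N (\<Sum>i\<in>I. c i *\<^sub>R x i) \<le> (\<Sum>i\<in>I. c i * N (x i))"
proof -
  have N0: "N 0 = 0" using assms(1) by (simp add: is_norm_def)
  show ?thesis
    using assms(2)
  proof (induction I rule: infinite_finite_induct)
    case (insert i I)
    have "N (c i *\<^sub>R x i + (\<Sum>i\<in>I. c i *\<^sub>R x i)) \<le> N (c i *\<^sub>R x i) + N (\<Sum>i\<in>I. c i *\<^sub>R x i)"
      using assms(1) unfolding is_norm_def by blast
    moreover have "N (c i *\<^sub>R x i) = c i * N (x i)"
      using assms(1) insert.prems unfolding is_norm_def by simp
    ultimately show ?case using insert by force
  qed (use N0 in simp_all)
qed

text \<open>Expansion in the basis shows that \<open>N\<close> is Lipschitz, so it attains a minimum
  on the compact Euclidean unit sphere. This minimum is positive, and homogeneity carries the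
  estimate to all vectors.\<close>

lemma is_norm_ge_norm:
  fixes N :: "real ^ 'n \<Rightarrow> real"
  assumes "is_norm N"
  obtains c where "\<And>x. norm x \<le> c * N x"
proof -
  define M where "M = (\<Sum>b\<in>Basis. N b)"
  have N: "\<And>x. 0 \<le> N x" "\<And>x. N x = 0 \<longleftrightarrow> x = 0" "\<And>c x. N (c *\<^sub>R x) = \<bar>c\<bar> * N x"
    "\<And>x y. N (x + y) \<le> N x + N y"
    using assms unfolding is_norm_def by blast+
  have upper: "N x \<le> M * norm x" for x
  proof -
    have "N x \<le> (\<Sum>b\<in>Basis. N ((x \<bullet> b) *\<^sub>R b))"
    proof -
      have "N (\<Sum>b\<in>B. g b) \<le> (\<Sum>b\<in>B. N (g b))" for B :: "(real^'n) set" and g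
        using is_norm_sum[OF assms, of B "\<lambda>_. 1" g] by simp
      from this[of "\<lambda>b. (x \<bullet> b) *\<^sub>R b" Basis] show ?thesis by (simp add: euclidean_representation)
    qed
    also have "\<dots> \<le> (\<Sum>b\<in>Basis. norm x * N b)"
      by (intro sum_mono) (auto simp: N Basis_le_norm intro!: mult_right_mono)
    finally show ?thesis by (simp add: M_def sum_distrib_left mult.commute)
  qed
  have diff: "\<bar>N x - N y\<bar> \<le> N (x - y)" for x y
    using N(4)[of "x - y" y] N(4)[of "y - x" x] N(3)[of "-1" "x - y"] by simp
  have "lipschitz_on M UNIV N"
    using order_trans[OF diff upper] N(1)
    by (intro lipschitz_onI) (auto simp: dist_norm M_def intro!: sum_nonneg)
  then have "continuous_on (sphere 0 1) N"
    by (meson continuous_on_subset lipschitz_on_continuous_on subset_UNIV)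
  moreover have "sphere 0 1 \<noteq> ({} :: (real^'n) set)" by simp
  ultimately obtain u where u: "u \<in> sphere 0 1" "\<forall>x\<in>sphere 0 1. N u \<le> N x"
    using continuous_attains_inf[OF compact_sphere] by blast
  have u0: "N u > 0" using u(1) N(1)[of u] N(2)[of u] by fastforce
  have "norm x \<le> (1 / N u) * N x" for x
  proof (cases "x = 0")
    case False
    then have "N u \<le> N (x /\<^sub>R norm x)" using u(2) by simp
    also have "\<dots> = N x / norm x" by (simp add: N divide_inverse)
    finally show ?thesis using u0 False by (simp add: field_simps)
  qed (simp add: N)
  then show ?thesis by (rule that)
qed

lemma dist_to_le:
  assumes "is_norm N" "y \<in> Q"
  shows "dist_to N x Q \<le> N (x - y)"
  unfolding dist_to_def
  using assms by (intro cINF_lower) (auto simp: is_norm_def bdd_below_def)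

lemma dist_to_triangle:
  assumes N: "is_norm N" and Q: "Q \<noteq> {}"
  shows "dist_to N x Q \<le> N (x - y) + dist_to N y Q"
proof -
  have "dist_to N x Q - N (x - y) \<le> dist_to N y Q"
    unfolding dist_to_def[of N y]
  proof (rule cINF_greatest[OF Q])
    fix q assume "q \<in> Q"
    then have "dist_to N x Q \<le> N (x - q)" by (rule dist_to_le[OF N])
    also have "\<dots> \<le> N (x - y) + N (y - q)"
      using N unfolding is_norm_def by (metis diff_add_cancel diff_add_eq add_diff_eq)
    finally show "dist_to N x Q - N (x - y) \<le> N (y - q)" by simp
  qed
  then show ?thesis by simp
qed

lemma dist_to_less_obtain:
  assumes "Q \<noteq> {}" "0 < e"
  obtains y where "y \<in> Q" "N (x - y) < dist_to N x Q + e"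
proof -
  have "\<exists>r\<in>(\<lambda>y. N (x - y)) ` Q. r < Inf ((\<lambda>y. N (x - y)) ` Q) + e"
    by (rule cInf_lessD) (use assms in auto)
  then show ?thesis using that unfolding dist_to_def by auto
qed

text \<open>If \<open>z\<close> is a recession direction of the component \<open>C\<close>, then
  \<open>p C + z\<close> lies in the sublevel set at distance \<open>N (- p C)\<close> from
  \<open>z\<close>. Only finitely many such values occur.\<close>

lemma dist_to_recession_bounded:
  fixes N :: "real ^ 'n \<Rightarrow> real"
  assumes N: "is_norm N" and f: "piecewise_affine f"
  obtains D where "\<And>z. z \<in> recession_cone (sublevel f) \<Longrightarrow> dist_to N z (sublevel f) \<le> D"
proof -
  obtain \<C> where \<C>: "finite \<C>" "\<And>C. C \<in> \<C> \<Longrightarrow> closed C \<and> convex C" "sublevel f = \<Union>\<C>"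
    using sublevel_piecewise_affine[OF f] by blast
  define p where "p = (\<lambda>C :: (real^'n) set. SOME x. x \<in> C)"
  have p: "p C \<in> C" if "C \<noteq> {}" for C using that unfolding p_def by (rule some_in_eq[THEN iffD2])
  have N0: "0 \<le> N x" for x using N by (simp add: is_norm_def)
  have "dist_to N z (sublevel f) \<le> (\<Sum>C\<in>\<C>. N (- p C))" if z: "z \<in> recession_cone (sublevel f)" for z
  proof -
    obtain x where "\<forall>t\<ge>0. x + t *\<^sub>R z \<in> sublevel f" using z unfolding recession_cone_def by blast
    then have "x + real n *\<^sub>R z \<in> \<Union>\<C>" for n using \<C>(3) by simp
    then obtain C where C: "C \<in> \<C>" "C \<noteq> {}" "\<And>p t. p \<in> C \<Longrightarrow> 0 \<le> t \<Longrightarrow> p + t *\<^sub>R z \<in> C"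
      using recession_limit_Union[OF \<C>(1,2) _ ray_recession_limit] by blast
    have "p C + 1 *\<^sub>R z \<in> sublevel f" using C p \<C>(3) by (metis UnionI zero_le_one)
    from dist_to_le[OF N this, of z] have "dist_to N z (sublevel f) \<le> N (- p C)" by simp
    also have "\<dots> \<le> (\<Sum>C\<in>\<C>. N (- p C))"
      using C(1) \<C>(1) N0 by (intro member_le_sum) auto
    finally show ?thesis .
  qed
  then show ?thesis by (rule that)
qed

section \<open>The error bound criterion\<close>

lemma error_bound_imp_recession:
  assumes N: "is_norm N" and f: "piecewise_affine f" and ne: "sublevel f \<noteq> {}"
    and eb: "has_error_bound N f V"
  shows "sublevel (recession_fun (pos_part f)) \<inter> recession_cone V \<subseteq> recession_cone (sublevel f)"
proof
  fix z assume z: "z \<in> sublevel (recession_fun (pos_part f)) \<inter> recession_cone V"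
  obtain \<tau> where \<tau>: "\<tau> > 0" "\<forall>x\<in>V. \<tau> * dist_to N x (sublevel f) \<le> pos_part f x"
    using eb unfolding has_error_bound_def by blast
  obtain x where x: "\<forall>t\<ge>0. x + t *\<^sub>R z \<in> V" using z unfolding recession_cone_def by blast
  obtain \<C> where \<C>: "finite \<C>" "\<And>C. C \<in> \<C> \<Longrightarrow> closed C \<and> convex C" "sublevel f = \<Union>\<C>"
    using sublevel_piecewise_affine[OF f] by blast
  have "\<forall>n. \<exists>y. y \<in> sublevel f \<and>
      N (x + real n *\<^sub>R z - y) < dist_to N (x + real n *\<^sub>R z) (sublevel f) + 1"
    using dist_to_less_obtain[OF ne, of 1 N] by (metis zero_less_one)
  then obtain y where y: "\<And>n. y n \<in> sublevel f"
    "\<And>n. N (x + real n *\<^sub>R z - y n) < dist_to N (x + real n *\<^sub>R z) (sublevel f) + 1"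
    by metis
  define F where "F = (\<lambda>n. pos_part f (x + real n *\<^sub>R z) / real n)"
  have lim: "F \<longlonglongrightarrow> recession_fun (pos_part f) z"
    unfolding F_def
    by (rule filterlim_compose[OF recession_fun_tendsto[OF f] filterlim_real_sequentially])
  \<comment> \<open>The limit is nonnegative because \<open>F\<close> is, and nonpositive by the
    choice of \<open>z\<close>; hence it is 0.\<close>
  moreover have "0 \<le> F n" for n by (simp add: F_def pos_part_def)
  ultimately have "0 \<le> recession_fun (pos_part f) z"
    by (meson LIMSEQ_le_const)
  then have lim: "F \<longlonglongrightarrow> 0" using lim z by (simp add: sublevel_def)
  obtain c where c: "\<And>x. norm x \<le> c * N x" using is_norm_ge_norm[OF N] by blast
  \<comment> \<open>A negative \<open>c\<close> would contradict the estimate at any nonzero vector;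
    \<open>axis undefined 1\<close> serves as one.\<close>
  have c0: "0 \<le> c"
  proof (rule ccontr)
    assume "\<not> 0 \<le> c"
    then have "c * N (axis undefined 1) \<le> 0"
      using N by (intro mult_nonpos_nonneg) (auto simp: is_norm_def)
    with c[of "axis undefined 1"] show False by simp
  qed
  \<comment> \<open>The error bound controls the gap by \<open>F n / \<tau>\<close>, and division by
    \<open>n\<close> removes the slack 1 in the choice of \<open>y n\<close>. So
    \<open>y n / n\<close> has the same limit \<open>z\<close> as the ray.\<close>
  have "(\<lambda>n. (x + real n *\<^sub>R z) /\<^sub>R real n - y n /\<^sub>R real n) \<longlonglongrightarrow> 0"
  proof (rule Lim_null_comparison)
    have "(\<lambda>n. c * (F n / \<tau> + 1 / real n)) \<longlonglongrightarrow> c * (0 / \<tau> + 0)"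
      using \<tau>(1) by (intro tendsto_intros lim lim_1_over_n) auto
    then show "(\<lambda>n. c * (F n / \<tau> + 1 / real n)) \<longlonglongrightarrow> 0" by simp
    show "\<forall>\<^sub>F n in sequentially. norm ((x + real n *\<^sub>R z) /\<^sub>R real n - y n /\<^sub>R real n)
        \<le> c * (F n / \<tau> + 1 / real n)"
      using eventually_gt_at_top[of 0]
    proof eventually_elim
      case (elim n)
      have "\<tau> * dist_to N (x + real n *\<^sub>R z) (sublevel f) \<le> pos_part f (x + real n *\<^sub>R z)"
        using \<tau>(2) x by simp
      then have "dist_to N (x + real n *\<^sub>R z) (sublevel f) \<le> pos_part f (x + real n *\<^sub>R z) / \<tau>"
        using \<tau>(1) by (simp add: field_simps)
      then have "N (x + real n *\<^sub>R z - y n) \<le> pos_part f (x + real n *\<^sub>R z) / \<tau> + 1"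
        using y(2)[of n] by simp
      then have "norm (x + real n *\<^sub>R z - y n) \<le> c * (pos_part f (x + real n *\<^sub>R z) / \<tau> + 1)"
        by (meson c c0 mult_left_mono order_trans)
      moreover have "norm ((x + real n *\<^sub>R z) /\<^sub>R real n - y n /\<^sub>R real n)
          = norm (x + real n *\<^sub>R z - y n) / real n"
        by (simp add: scaleR_diff_right[symmetric] divide_inverse)
      ultimately show ?case using elim by (simp add: F_def field_simps)
    qed
  qed
  from tendsto_diff[OF ray_recession_limit[of x z] this]
  have "(\<lambda>n. y n /\<^sub>R real n) \<longlonglongrightarrow> z" by simp
  then obtain C where C: "C \<in> \<C>" "C \<noteq> {}" "\<And>p t. p \<in> C \<Longrightarrow> 0 \<le> t \<Longrightarrow> p + t *\<^sub>R z \<in> C"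
    using recession_limit_Union[OF \<C>(1,2), of y z] y(1) \<C>(3) by blast
  then show "z \<in> recession_cone (sublevel f)"
    unfolding recession_cone_def \<C>(3) by blast
qed

text \<open>The sum of all ratios serves as the constant; unlike a maximum it also makes sense for
  empty \<open>G\<close>.\<close>

lemma finite_ratio_bound:
  fixes u v :: "'a \<Rightarrow> real"
  assumes "finite G" "\<And>g. g \<in> G \<Longrightarrow> 0 \<le> u g" "\<And>g. g \<in> G \<Longrightarrow> 0 < v g"
  obtains C where "0 \<le> C" "\<And>g. g \<in> G \<Longrightarrow> u g \<le> C * v g"
proof -
  have "u g \<le> (\<Sum>g\<in>G. u g / v g) * v g" if "g \<in> G" for g
  proof -
    have "u g / v g \<le> (\<Sum>g\<in>G. u g / v g)"
      using that assms by (intro member_le_sum divide_nonneg_pos) auto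
    then show ?thesis using assms(3)[OF that] by (simp add: field_simps)
  qed
  moreover have "0 \<le> (\<Sum>g\<in>G. u g / v g)"
    by (intro sum_nonneg divide_nonneg_pos assms) auto
  ultimately show ?thesis using that by blast
qed

text \<open>A Hoffman-type bound: shrinking the part of \<open>x\<close> carried by the generators with positive value,
  in favour of the point \<open>w\<close>, brings the value down to at most zero.\<close>

lemma polyhedron_affine_error_bound:
  fixes v :: "real ^ 'n"
  assumes N: "is_norm N" and W: "polyhedron W" and w: "w \<in> W" "a + v \<bullet> w \<le> 0"
  obtains C where "0 \<le> C"
    "\<And>x. x \<in> W \<Longrightarrow> 0 < a + v \<bullet> x \<Longrightarrow> \<exists>y\<in>W. a + v \<bullet> y \<le> 0 \<and> N (x - y) \<le> C * (a + v \<bullet> x)"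
proof -
  obtain G :: "((real^'n) \<times> real) set" where G: "finite G" "\<And>g. g \<in> G \<Longrightarrow> 0 \<le> snd g"
    "\<And>x. x \<in> W \<longleftrightarrow> (x, 1) \<in> convex_cone hull G"
    using polyhedron_homogenization[OF W] by blast
  \<comment> \<open>The linear function on the homogenized space with
    \<open>L (x, 1) = a + v \<bullet> x\<close>.\<close>
  define L where "L = (\<lambda>g :: (real^'n) \<times> real. v \<bullet> fst g + a * snd g)"
  have L_lin: "L (\<Sum>g\<in>H. c g *\<^sub>R g) = (\<Sum>g\<in>H. c g * L g)" for c H
    unfolding L_def
    by (simp add: fst_sum snd_sum inner_sum_right sum_distrib_left sum.distrib[symmetric] algebra_simps)
  define P where "P = {g\<in>G. L g > 0}"
  have finP: "finite P" and PG: "P \<subseteq> G" using G(1) by (auto simp: P_def)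
  have Nn: "\<And>x. 0 \<le> N x" "\<And>c x. N (c *\<^sub>R x) = \<bar>c\<bar> * N x" "\<And>x y. N (x + y) \<le> N x + N y"
    using N unfolding is_norm_def by blast+
  \<comment> \<open>The displacement caused by replacing the generator \<open>g\<close> by the
    multiple of \<open>(w, 1)\<close> of the same height.\<close>
  define q where "q = (\<lambda>g. fst g - snd g *\<^sub>R w)"
  obtain C where C: "0 \<le> C" "\<And>g. g \<in> P \<Longrightarrow> N (q g) \<le> C * L g"
    using finite_ratio_bound[OF finP, of "\<lambda>g. N (q g)" L] Nn(1) unfolding P_def by blast
  have "\<exists>y\<in>W. a + v \<bullet> y \<le> 0 \<and> N (x - y) \<le> C * (a + v \<bullet> x)"
    if x: "x \<in> W" "0 < a + v \<bullet> x" for x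
  proof -
    obtain c where c: "\<And>g. g \<in> G \<Longrightarrow> 0 \<le> c g" "(x, 1) = (\<Sum>g\<in>G. c g *\<^sub>R g)"
      using x(1) G(3) convex_cone_hull_finite_obtain[OF G(1)] by blast
    define p where "p = (\<Sum>g\<in>P. c g *\<^sub>R g)"
    define A where "A = L p"
    \<comment> \<open>The fraction of \<open>p\<close> whose removal lowers \<open>L\<close> by
      exactly \<open>a + v \<bullet> x\<close>. It is at most 1 because the generators outside
      \<open>P\<close> contribute nothing positive.\<close>
    define \<theta> where "\<theta> = (a + v \<bullet> x) / A"
    define y where "y = x - \<theta> *\<^sub>R (fst p - snd p *\<^sub>R w)"
    have "(x, 1) = (\<Sum>g\<in>G-P. c g *\<^sub>R g) + p"
      unfolding c(2) p_def using sum.subset_diff[OF PG G(1)] .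
    then have p: "(x, 1) - p = (\<Sum>g\<in>G-P. c g *\<^sub>R g)" by (simp add: eq_diff_eq)
    have "a + v \<bullet> x = L (x, 1)" by (simp add: L_def)
    also have "\<dots> = L ((x, 1) - p) + A" by (simp add: A_def L_def inner_diff_right algebra_simps)
    also have "L ((x, 1) - p) \<le> 0"
      unfolding p L_lin by (intro sum_nonpos mult_nonneg_nonpos c) (auto simp: P_def)
    finally have A: "a + v \<bullet> x \<le> A" by simp
    then have A0: "A > 0" using x by simp
    have \<theta>: "0 \<le> \<theta>" "\<theta> \<le> 1" using A A0 x(2) by (auto simp: \<theta>_def)
    have snd_p: "0 \<le> snd p"
      unfolding p_def snd_sum using G(2) c(1) PG by (intro sum_nonneg) auto
    have "(x, 1) - p \<in> convex_cone hull G"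
      unfolding p by (intro convex_cone_hull_sum convex_cone_hull_mul hull_inc c(1)) auto
    moreover have "p \<in> convex_cone hull G"
      unfolding p_def using PG by (intro convex_cone_hull_sum convex_cone_hull_mul hull_inc c(1)) auto
    \<comment> \<open>The multiple of \<open>(w, 1)\<close> restores the height lost with the
      removed part of \<open>p\<close>, so the new point is again at height 1.\<close>
    ultimately have "((x, 1) - p) + (1 - \<theta>) *\<^sub>R p + (\<theta> * snd p) *\<^sub>R (w, 1) \<in> convex_cone hull G"
      using w(1) G(3) \<theta> snd_p by (intro convex_cone_hull_add convex_cone_hull_mul) auto
    also have "((x, 1) - p) + (1 - \<theta>) *\<^sub>R p + (\<theta> * snd p) *\<^sub>R (w, 1) = (y, 1)"
      by (simp add: y_def prod_eq_iff algebra_simps)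
    finally have yW: "y \<in> W" using G(3) by simp
    have "a + v \<bullet> y = (a + v \<bullet> x) - \<theta> * A + \<theta> * snd p * (a + v \<bullet> w)"
      by (simp add: y_def A_def L_def inner_diff_right algebra_simps)
    also have "\<theta> * A = a + v \<bullet> x" using A0 by (simp add: \<theta>_def)
    also have "(a + v \<bullet> x) - (a + v \<bullet> x) + \<theta> * snd p * (a + v \<bullet> w) \<le> 0"
      using mult_nonneg_nonpos[OF mult_nonneg_nonneg[OF \<theta>(1) snd_p] w(2)] by simp
    finally have y0: "a + v \<bullet> y \<le> 0" .
    have "fst p - snd p *\<^sub>R w = (\<Sum>g\<in>P. c g *\<^sub>R q g)"
      by (simp add: p_def q_def fst_sum snd_sum scaleR_sum_left scaleR_diff_right sum_subtractf)
    then have "N (fst p - snd p *\<^sub>R w) \<le> (\<Sum>g\<in>P. c g * N (q g))"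
      using is_norm_sum[OF N, of P c q] c(1) PG by auto
    also have "\<dots> \<le> (\<Sum>g\<in>P. c g * (C * L g))"
      using c(1) PG by (intro sum_mono mult_left_mono C) auto
    also have "\<dots> = C * A" by (simp add: A_def p_def L_lin sum_distrib_left mult_ac)
    finally have "\<theta> * N (fst p - snd p *\<^sub>R w) \<le> \<theta> * (C * A)" using \<theta>(1) by (rule mult_left_mono)
    moreover have "N (x - y) = \<theta> * N (fst p - snd p *\<^sub>R w)" using \<theta>(1) by (simp add: y_def Nn(2))
    ultimately have "N (x - y) \<le> C * (a + v \<bullet> x)" using A0 by (simp add: \<theta>_def mult.commute)
    with yW y0 show ?thesis by blast
  qed
  then show ?thesis using that C(1) by blast
qed

text \<open>Where the affine function is positive on the polyhedron, no generator has a negative value, and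
  those of value zero span recession directions along which the function is constant.\<close>

lemma polyhedron_affine_positive:
  fixes v :: "real ^ 'n"
  assumes N: "is_norm N" and W: "polyhedron W" "W \<noteq> {}" and pos: "\<And>x. x \<in> W \<Longrightarrow> 0 < a + v \<bullet> x"
  obtains C where "0 \<le> C" "\<And>x. x \<in> W \<Longrightarrow> 1 \<le> C * (a + v \<bullet> x)"
    "\<And>x. x \<in> W \<Longrightarrow> \<exists>z. v \<bullet> z = 0 \<and> (\<forall>w\<in>W. \<forall>t\<ge>0. w + t *\<^sub>R z \<in> W) \<and> N (x - z) \<le> C * (a + v \<bullet> x)"
proof -
  obtain G :: "((real^'n) \<times> real) set" where G: "finite G" "\<And>g. g \<in> G \<Longrightarrow> 0 \<le> snd g"
    "\<And>x. x \<in> W \<longleftrightarrow> (x, 1) \<in> convex_cone hull G"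
    using polyhedron_homogenization[OF W(1)] by blast
  define L where "L = (\<lambda>g :: (real^'n) \<times> real. v \<bullet> fst g + a * snd g)"
  have L_lin: "L (\<Sum>g\<in>H. c g *\<^sub>R g) = (\<Sum>g\<in>H. c g * L g)" for c H
    unfolding L_def
    by (simp add: fst_sum snd_sum inner_sum_right sum_distrib_left sum.distrib[symmetric] algebra_simps)
  have rec: "w + t *\<^sub>R z \<in> W" if "(z, 0) \<in> convex_cone hull G" "w \<in> W" "0 \<le> t" for w z t
  proof -
    have "(w, 1) + t *\<^sub>R (z, 0) \<in> convex_cone hull G"
      using that G(3) by (intro convex_cone_hull_add convex_cone_hull_mul) auto
    then show ?thesis using G(3) by simp
  qed
  obtain w0 where w0: "w0 \<in> W" using W(2) by blast
  \<comment> \<open>A generator at height 0 is a recession direction; a negative slope along it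
    would bring the function down to 0 on \<open>W\<close>. A generator at positive height rescales
    to a point of \<open>W\<close>, where the function is positive.\<close>
  have L0: "L g \<ge> 0 \<and> (L g = 0 \<longrightarrow> snd g = 0)" if g: "g \<in> G" for g
  proof (cases "snd g = 0")
    case True
    then have "(fst g, 0) \<in> convex_cone hull G" using hull_inc[OF g, of convex_cone] by (metis prod.collapse)
    then have *: "0 < a + v \<bullet> w0 + t * (v \<bullet> fst g)" if "0 \<le> t" for t
      using pos[OF rec[OF _ w0 that]] by (simp add: inner_right_distrib add.assoc)
    have "v \<bullet> fst g \<ge> 0"
    proof (rule ccontr)
      assume neg: "\<not> v \<bullet> fst g \<ge> 0"
      have "0 < a + v \<bullet> w0 + ((a + v \<bullet> w0) / - (v \<bullet> fst g)) * (v \<bullet> fst g)"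
        using neg pos[OF w0] by (intro * divide_nonneg_pos) auto
      then show False using neg by simp
    qed
    then show ?thesis using True by (simp add: L_def)
  next
    case False
    then have s: "snd g > 0" using G(2)[OF g] by simp
    have "(1 / snd g) *\<^sub>R g \<in> convex_cone hull G"
      using s by (intro convex_cone_hull_mul hull_inc g) auto
    moreover have "(1 / snd g) *\<^sub>R g = ((1 / snd g) *\<^sub>R fst g, 1)" using s by (simp add: prod_eq_iff)
    ultimately have "(1 / snd g) *\<^sub>R fst g \<in> W" using G(3) by metis
    then have "0 < a + v \<bullet> ((1 / snd g) *\<^sub>R fst g)" by (rule pos)
    then have "0 < L g" using s by (simp add: L_def field_simps)
    then show ?thesis by simp
  qed
  define P where "P = {g\<in>G. L g > 0}"
  have finP: "finite P" and PG: "P \<subseteq> G" using G(1) by (auto simp: P_def)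
  have Nn: "\<And>x. 0 \<le> N x" using N unfolding is_norm_def by blast+
  \<comment> \<open>Including \<open>snd g\<close> yields both bounds from one constant: the part
    \<open>p\<close> of \<open>(x, 1)\<close> carries the whole height 1, so its height gives
    \<open>1 \<le> C * (a + v \<bullet> x)\<close>.\<close>
  obtain C where C: "0 \<le> C" "\<And>g. g \<in> P \<Longrightarrow> N (fst g) + snd g \<le> C * L g"
    using finite_ratio_bound[OF finP, of "\<lambda>g. N (fst g) + snd g" L] Nn G(2) PG unfolding P_def
    by (metis (no_types, lifting) add_nonneg_nonneg mem_Collect_eq)
  have main: "1 \<le> C * (a + v \<bullet> x) \<and>
      (\<exists>z. v \<bullet> z = 0 \<and> (\<forall>w\<in>W. \<forall>t\<ge>0. w + t *\<^sub>R z \<in> W) \<and> N (x - z) \<le> C * (a + v \<bullet> x))"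
    if x: "x \<in> W" for x
  proof -
    obtain c where c: "\<And>g. g \<in> G \<Longrightarrow> 0 \<le> c g" "(x, 1) = (\<Sum>g\<in>G. c g *\<^sub>R g)"
      using x(1) G(3) convex_cone_hull_finite_obtain[OF G(1)] by blast
    define p where "p = (\<Sum>g\<in>P. c g *\<^sub>R g)"
    \<comment> \<open>Only generators of value 0, hence of height 0, remain here;
      \<open>fst r\<close> is the required direction \<open>z\<close>.\<close>
    define r where "r = (\<Sum>g\<in>G-P. c g *\<^sub>R g)"
    have xpr: "(x, 1) = r + p"
      unfolding c(2) p_def r_def using sum.subset_diff[OF PG G(1)] .
    have r0: "snd r = 0" "L r = 0"
    proof -
      have "snd g = 0" "L g = 0" if "g \<in> G - P" for g using L0 that by (auto simp: P_def less_le)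
      then show "snd r = 0" "L r = 0" unfolding r_def L_lin by (auto simp: snd_sum)
    qed
    have Lx: "a + v \<bullet> x = L p"
    proof -
      have "a + v \<bullet> x = L (x, 1)" by (simp add: L_def)
      also have "\<dots> = L r + L p" unfolding xpr by (simp add: L_def inner_right_distrib algebra_simps)
      finally show ?thesis using r0 by simp
    qed
    have "N (fst p) + snd p \<le> (\<Sum>g\<in>P. c g * N (fst g)) + (\<Sum>g\<in>P. c g * snd g)"
      using is_norm_sum[OF N, of P c fst] c(1) PG by (auto simp: p_def fst_sum snd_sum)
    also have "\<dots> = (\<Sum>g\<in>P. c g * (N (fst g) + snd g))" by (simp add: sum.distrib algebra_simps)
    also have "\<dots> \<le> (\<Sum>g\<in>P. c g * (C * L g))"
      using c(1) PG by (intro sum_mono mult_left_mono C) auto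
    also have "\<dots> = C * (a + v \<bullet> x)" by (simp add: Lx p_def L_lin sum_distrib_left mult_ac)
    finally have bound: "N (fst p) + snd p \<le> C * (a + v \<bullet> x)" .
    have xp: "x = fst r + fst p" "snd p = 1" using xpr r0 by (auto simp: prod_eq_iff)
    have "r \<in> convex_cone hull G"
      unfolding r_def by (intro convex_cone_hull_sum convex_cone_hull_mul hull_inc c(1)) auto
    then have "(fst r, 0) \<in> convex_cone hull G" using r0 by (metis prod.collapse)
    then have "\<forall>w\<in>W. \<forall>t\<ge>0. w + t *\<^sub>R fst r \<in> W" using rec by blast
    moreover have "v \<bullet> fst r = 0" using r0 by (simp add: L_def)
    moreover have "N (x - fst r) \<le> C * (a + v \<bullet> x)" using bound xp by simp
    moreover have "1 \<le> C * (a + v \<bullet> x)" using bound xp(2) Nn[of "fst p"] by simp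
    ultimately show ?thesis by blast
  qed
  show ?thesis by (rule that[of C]) (use C(1) main in auto)
qed

text \<open>The bound is stated with a factor \<open>C \<ge> 0\<close> on the right, so that the
  constants of finitely many polyhedra can be added.\<close>

lemma polyhedron_error_bound:
  assumes N: "is_norm N" and f: "piecewise_affine f" and ne: "sublevel f \<noteq> {}"
    and incl: "sublevel (recession_fun (pos_part f)) \<inter> recession_cone V \<subseteq> recession_cone (sublevel f)"
    and W: "polyhedron W" "W \<subseteq> V" and aff: "\<And>x. x \<in> W \<Longrightarrow> f x = a + v \<bullet> x"
  shows "\<exists>C\<ge>0. \<forall>x\<in>W. dist_to N x (sublevel f) \<le> C * pos_part f x"
proof (cases "\<exists>w\<in>W. a + v \<bullet> w \<le> 0")
  case True
  then obtain w where w: "w \<in> W" "a + v \<bullet> w \<le> 0" by blast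
  obtain C where C: "0 \<le> C"
    "\<And>x. x \<in> W \<Longrightarrow> 0 < a + v \<bullet> x \<Longrightarrow> \<exists>y\<in>W. a + v \<bullet> y \<le> 0 \<and> N (x - y) \<le> C * (a + v \<bullet> x)"
    using polyhedron_affine_error_bound[OF N W(1) w] by blast
  have "dist_to N x (sublevel f) \<le> C * pos_part f x" if x: "x \<in> W" for x
  proof (cases "0 < f x")
    case True
    then obtain y where y: "y \<in> W" "a + v \<bullet> y \<le> 0" "N (x - y) \<le> C * f x"
      using C(2)[OF x] aff[OF x] by auto
    then have "y \<in> sublevel f" using aff by (simp add: sublevel_def)
    from dist_to_le[OF N this, of x] show ?thesis using y(3) True by (simp add: pos_part_def)
  next
    case False
    then have "x \<in> sublevel f" by (simp add: sublevel_def)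
    moreover have "N (x - x) = 0" using N by (simp add: is_norm_def)
    ultimately have "dist_to N x (sublevel f) \<le> 0" using dist_to_le[OF N] by metis
    then show ?thesis using False by (simp add: pos_part_def max_def)
  qed
  then show ?thesis using C(1) by blast
next
  case False
  then have pos: "\<And>x. x \<in> W \<Longrightarrow> 0 < a + v \<bullet> x" by force
  show ?thesis
  proof (cases "W = {}")
    case True
    then show ?thesis by auto
  next
    case False
    then obtain w where w: "w \<in> W" by blast
    obtain C where C: "0 \<le> C" "\<And>x. x \<in> W \<Longrightarrow> 1 \<le> C * (a + v \<bullet> x)"
      "\<And>x. x \<in> W \<Longrightarrow> \<exists>z. v \<bullet> z = 0 \<and> (\<forall>w\<in>W. \<forall>t\<ge>0. w + t *\<^sub>R z \<in> W) \<and> N (x - z) \<le> C * (a + v \<bullet> x)"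
      using polyhedron_affine_positive[where a=a and v=v, OF N W(1) False pos] by blast
    obtain D where D: "\<And>z. z \<in> recession_cone (sublevel f) \<Longrightarrow> dist_to N z (sublevel f) \<le> D"
      using dist_to_recession_bounded[OF N f] by blast
    have "dist_to N x (sublevel f) \<le> (C + \<bar>D\<bar> * C) * pos_part f x" if x: "x \<in> W" for x
    proof -
      obtain z where z: "v \<bullet> z = 0" "\<forall>w\<in>W. \<forall>t\<ge>0. w + t *\<^sub>R z \<in> W" "N (x - z) \<le> C * (a + v \<bullet> x)"
        using C(3)[OF x] by blast
      have "z \<in> recession_cone V" unfolding recession_cone_def using w z(2) W(2) by blast
      moreover have "recession_fun (pos_part f) z = 0"
      \<comment> \<open>\<open>f\<close> is constant on the ray from \<open>w\<close> in direction
        \<open>z\<close>, and the recession function may be computed along that ray.\<close>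
      proof (rule tendsto_unique[OF _ recession_fun_tendsto[OF f, of w z]])
        have "((\<lambda>t::real. pos_part f w / t) \<longlongrightarrow> 0) at_top"
          by (rule real_tendsto_divide_at_top[OF tendsto_const filterlim_ident])
        moreover have "\<forall>\<^sub>F t in at_top. pos_part f w / t = pos_part f (w + t *\<^sub>R z) / t"
          using eventually_ge_at_top[of 0]
          by eventually_elim (use z w aff in \<open>simp add: pos_part_def inner_right_distrib\<close>)
        ultimately show "((\<lambda>t. pos_part f (w + t *\<^sub>R z) / t) \<longlongrightarrow> 0) at_top"
          by (rule Lim_transform_eventually)
      qed simp
      ultimately have "z \<in> recession_cone (sublevel f)" using incl by (auto simp: sublevel_def)
      \<comment> \<open>The constant bound becomes a multiple of \<open>f x\<close> through
        \<open>1 \<le> C * (a + v \<bullet> x)\<close>; the absolute value makes the factor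
        nonnegative.\<close>
      then have "dist_to N z (sublevel f) \<le> \<bar>D\<bar> * 1" using D[of z] by simp
      also have "\<dots> \<le> \<bar>D\<bar> * (C * (a + v \<bullet> x))" by (intro mult_left_mono C x) auto
      finally have "dist_to N x (sublevel f) \<le> C * (a + v \<bullet> x) + \<bar>D\<bar> * (C * (a + v \<bullet> x))"
        using dist_to_triangle[OF N ne, of x z] z(3) by simp
      then show ?thesis using aff[OF x] pos[OF x] by (simp add: pos_part_def algebra_simps)
    qed
    then show ?thesis using C(1) by (intro exI[of _ "C + \<bar>D\<bar> * C"]) auto
  qed
qed

text \<open>Intersecting the polyhedra of \<open>V\<close> with the pieces of \<open>f\<close>
  leaves finitely many polyhedra on which \<open>f\<close> is affine.\<close>

lemma recession_imp_error_bound: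
  assumes N: "is_norm N" and f: "piecewise_affine f" and ne: "sublevel f \<noteq> {}"
    and V: "polyhedral_union V"
    and incl: "sublevel (recession_fun (pos_part f)) \<inter> recession_cone V \<subseteq> recession_cone (sublevel f)"
  shows "has_error_bound N f V"
proof -
  obtain K :: "nat set" and Q a v where K [rule_format]: "finite K" "\<forall>k\<in>K. polyhedron (Q k)"
    "(\<Union>k\<in>K. Q k) = UNIV" "\<forall>k\<in>K. \<forall>x\<in>Q k. f x = a k + v k \<bullet> x"
    by (rule piecewise_affine_obtain[OF f]) (rule that)
  obtain \<P> where \<P>: "finite \<P>" "\<forall>P\<in>\<P>. polyhedron P" "V = \<Union>\<P>"
    using V unfolding polyhedral_union_def by blast
  have "\<exists>C\<ge>0. \<forall>x\<in>fst i \<inter> Q (snd i). dist_to N x (sublevel f) \<le> C * pos_part f x"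
    if "i \<in> \<P> \<times> K" for i
    using that K(2,4) \<P>(2,3)
    by (intro polyhedron_error_bound[where V=V and a="a (snd i)" and v="v (snd i)"] N f ne incl) auto
  then obtain C where C: "\<And>i. i \<in> \<P> \<times> K \<Longrightarrow> 0 \<le> C i"
    "\<And>i x. i \<in> \<P> \<times> K \<Longrightarrow> x \<in> fst i \<inter> Q (snd i) \<Longrightarrow> dist_to N x (sublevel f) \<le> C i * pos_part f x"
    by metis
  \<comment> \<open>The summand 1 keeps \<open>M\<close> positive even if all constants
    vanish.\<close>
  define M where "M = 1 + (\<Sum>i\<in>\<P>\<times>K. C i)"
  have M: "M > 0" unfolding M_def using C(1) by (intro add_pos_nonneg sum_nonneg) auto
  have "(1 / M) * dist_to N x (sublevel f) \<le> pos_part f x" if x: "x \<in> V" for x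
  proof -
    obtain P where P: "P \<in> \<P>" "x \<in> P" using x \<P>(3) by blast
    obtain k where k: "k \<in> K" "x \<in> Q k" using K(3) by blast
    have "C (P, k) \<le> (\<Sum>i\<in>\<P>\<times>K. C i)"
      using P k K(1) \<P>(1) C(1) by (intro member_le_sum) auto
    then have "C (P, k) * pos_part f x \<le> M * pos_part f x"
      by (intro mult_right_mono) (auto simp: M_def pos_part_def)
    then have "dist_to N x (sublevel f) \<le> M * pos_part f x"
      using C(2)[of "(P, k)" x] P k by auto
    then show ?thesis using M by (simp add: field_simps)
  qed
  then show ?thesis unfolding has_error_bound_def using M by (intro exI[of _ "1 / M"]) auto
qed

theorem theorem9:
  fixes N :: "real ^ 'n \<Rightarrow> real" and f :: "real ^ 'n \<Rightarrow> real" and V :: "(real ^ 'n) set"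
  assumes "is_norm N"
    and "piecewise_affine f"
    and "sublevel f \<noteq> {}"
    and "polyhedral_union V"
  shows "has_error_bound N f V \<longleftrightarrow>
    sublevel (recession_fun (pos_part f)) \<inter> recession_cone V \<subseteq> recession_cone (sublevel f)"
  using error_bound_imp_recession[OF assms(1-3)] recession_imp_error_bound[OF assms] by blast

end
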